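(* For all integers $t\ge 0$ and $\ell_1,\ldots,\ell_t\ge 0$, the Grundy values of the game $CSG(\{1,2,3\})$ satisfy $\mathcal{G}_{\{1,2,3\}}(S_{\ell_1,\ldots,\ell_t})=\mathcal{G}_{\{1,2,3\}}(S_{\ell_1\bmod 4,\ldots,\ell_t\bmod 4})$.
   Context: For a set $L$ of positive integers, the game $CSG(L)$ on a connected graph $G$ is the two-player impartial game in which a move consists in removing from the current graph a connected subgraph $H$ such that $|V(H)|\in L$ and the remaining graph is connected (the empty graph counts as connected, so removing the whole graph is allowed when its size is in $L$). The player unable to move loses. $\mathcal{G}_L(G)$ is the Grundy value of $CSG(L)$ on $G$. The subdivided star $S_{\ell_1,\ldots,\ell_t}$ is obtained from a central vertex by attaching $t$ disjoint paths with $\ell_1,\ldots,\ell_t$ vertices respectively (an endpoint of each path adjacent to the center; paths with $0$ vertices allowed). *)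

theory Defs
  imports "Graph_Theory.Graph_Theory"
begin

text \<open>
  Finite simple undirected graphs are represented, by the library's locale
  predicate \<^const>\<open>graph\<close>: finite symmetric digraphs without loops and parallel arcs.
  The library predicate \<^const>\<open>connected\<close> requires a nonempty vertex set, so that the empty
  remaining graph is admitted by a separate disjunct.  The subgraph \<open>H\<close> need not be induced.
\<close>

definition csg_move :: "nat set \<Rightarrow> ('a,'b) pre_digraph \<Rightarrow> ('a,'b) pre_digraph \<Rightarrow> bool" where
  "csg_move L G G' \<longleftrightarrow> graph G \<and>
     (\<exists>H. subgraph H G \<and> symmetric H \<and> connected H \<and> card (verts H) \<in> L \<and>
          G' = G \<restriction> (verts G - verts H) \<and> (verts G' = {} \<or> connected G'))"

lemma csg_move_card_less:
  assumes "csg_move L G G'"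
  shows "card (verts G') < card (verts G)"
proof -
  from assms obtain H where "graph G" and H: "subgraph H G" "connected H"
    and G': "verts G' = verts G - verts H"
    by (auto simp: csg_move_def)
  from H have "verts H \<subseteq> verts G" "verts H \<noteq> {}"
    by (auto simp: connected_def strongly_connected_def)
  moreover have "finite (verts G)"
    using \<open>graph G\<close> by (simp add: graph_def digraph_def fin_digraph.finite_verts)
  ultimately show ?thesis
    unfolding G' by (intro psubset_card_mono) auto
qed

definition mex :: "nat set \<Rightarrow> nat" where
  "mex S = (LEAST n. n \<notin> S)"

function csg_grundy :: "nat set \<Rightarrow> ('a,'b) pre_digraph \<Rightarrow> nat" where
  "csg_grundy L G = mex (csg_grundy L ` {G'. csg_move L G G'})"
  by auto
termination
  by (relation "measure (\<lambda>(L, G). card (verts G))") (auto dest: csg_move_card_less)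

declare csg_grundy.simps [simp del]

text \<open>The \<open>j\<close>-th vertex of the \<open>i\<close>-th attached path is \<open>Leg i j\<close>, both counted from \<open>0\<close>.\<close>

datatype star_vertex = Center | Leg nat nat

definition star_arcs :: "nat list \<Rightarrow> star_vertex rel" where
  "star_arcs ls =
     {(Center, Leg i 0) | i. i < length ls \<and> 0 < ls ! i} \<union>
     {(Leg i j, Leg i (Suc j)) | i j. i < length ls \<and> Suc j < ls ! i}"

definition subdivided_star :: "nat list \<Rightarrow> star_vertex pair_pre_digraph" where
  "subdivided_star ls =
     \<lparr> pverts = insert Center {Leg i j | i j. i < length ls \<and> j < ls ! i},
       parcs = star_arcs ls \<union> (star_arcs ls)\<inverse> \<rparr>"

lemma graph_subdivided_star: "graph (subdivided_star ls)"
proof -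
  have "{Leg i j | i j. i < length ls \<and> j < ls ! i} =
      (\<lambda>(i, j). Leg i j) ` (SIGMA i:{..<length ls}. {..<ls ! i})"
    by auto
  then have fin: "finite (pverts (subdivided_star ls))"
    by (simp add: subdivided_star_def)
  have sub: "parcs (subdivided_star ls) \<subseteq>
      pverts (subdivided_star ls) \<times> pverts (subdivided_star ls)"
    by (auto simp: subdivided_star_def star_arcs_def)
  have "pair_graph (subdivided_star ls)"
  proof
    show "finite (parcs (subdivided_star ls))"
      using fin sub by (meson finite_SigmaI finite_subset)
    show "symmetric (subdivided_star ls)"
      by (auto simp: symmetric_def subdivided_star_def sym_def)
  qed (use fin sub in \<open>auto simp: subdivided_star_def star_arcs_def\<close>)
  then show ?thesis
    by (rule pair_graph.pair_graphD_graph)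
qed

lemma connected_subdivided_star: "connected (subdivided_star ls)"
proof -
  let ?G = "with_proj (subdivided_star ls)"
  interpret graph ?G by (rule graph_subdivided_star)
  have arcs: "arcs_ends ?G = star_arcs ls \<union> (star_arcs ls)\<inverse>"
    by (simp add: subdivided_star_def)
  have C: "Center \<in> verts ?G" by (simp add: subdivided_star_def)
  have leg: "Center \<rightarrow>\<^sup>*\<^bsub>?G\<^esub> Leg i j" if "i < length ls" "j < ls ! i" for i j
    using that
  proof (induction j)
    case 0
    then have "(Center, Leg i 0) \<in> arcs_ends ?G"
      unfolding arcs by (auto simp: star_arcs_def)
    then show ?case by (rule reachable_adjI)
  next
    case (Suc j)
    then have "(Leg i j, Leg i (Suc j)) \<in> arcs_ends ?G"
      unfolding arcs by (auto simp: star_arcs_def)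
    then show ?case using Suc by (meson Suc_lessD reachable_adj_trans)
  qed
  have all: "Center \<rightarrow>\<^sup>*\<^bsub>?G\<^esub> v" if "v \<in> verts ?G" for v
  proof -
    from that consider "v = Center" | i j where "v = Leg i j" "i < length ls" "j < ls ! i"
      by (auto simp: subdivided_star_def)
    then show ?thesis
      using leg C by cases auto
  qed
  have "strongly_connected ?G"
  proof (rule strongly_connectedI)
    show "verts ?G \<noteq> {}" using C by blast
    fix u v assume "u \<in> verts ?G" "v \<in> verts ?G"
    from all[OF this(1)] have "u \<rightarrow>\<^sup>*\<^bsub>?G\<^esub> Center"
      by (rule symmetric_reachable[OF sym_arcs])
    then show "u \<rightarrow>\<^sup>*\<^bsub>?G\<^esub> v"
      using all[OF \<open>v \<in> verts ?G\<close>] by (rule reachable_trans)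
  qed
  then show ?thesis
    by (auto simp: connected_def strongly_connected_def intro: reachable_mk_symmetricI)
qed

end

theory Submission
  imports Defs
begin

text \<open>
  Moves on a path only shorten it by one to three vertices, so a path on \<open>n\<close> vertices has value
  \<open>n mod 4\<close>.  A star with at least three nontrivial legs admits moves shortening one leg, and
  moves removing the center only if its legs are \<open>l, 1, 1\<close>; there the value is
  \<open>(l + 3) mod 4\<close>, and removing the center, with value \<open>l mod 4\<close>, does not influence it.
  Except for a few small cases, the value of a star is therefore determined by its leg moves.

  Lengthening a leg of \<open>S\<close> by \<open>4\<close> then preserves the value by induction: the leg moves of \<open>S\<close>
  reappear with the same values, and every additional leg move leads to a position from which
  \<open>S\<close> itself can be reached, hence to a value different from that of \<open>S\<close>.
\<close>

section \<open>Positions as induced subgraphs of one fixed infinite tree\<close>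

definition child :: "star_vertex \<Rightarrow> star_vertex \<Rightarrow> bool" where
  "child u v \<longleftrightarrow> (\<exists>i. u = Center \<and> v = Leg i 0) \<or> (\<exists>i j. u = Leg i j \<and> v = Leg i (Suc j))"

definition adj :: "star_vertex \<Rightarrow> star_vertex \<Rightarrow> bool" where
  "adj u v \<longleftrightarrow> child u v \<or> child v u"

text \<open>Adjacency lives on a single tree with infinitely many infinite legs, so a position is an
  induced subgraph and is determined by its vertex set alone.\<close>

definition tree_on :: "star_vertex set \<Rightarrow> star_vertex pair_pre_digraph" where
  "tree_on U = \<lparr> pverts = U, parcs = {(u, v). u \<in> U \<and> v \<in> U \<and> adj u v} \<rparr>"

abbreviation conn :: "star_vertex set \<Rightarrow> bool" where
  "conn U \<equiv> connected (with_proj (tree_on U))"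

lemma adj_sym: "adj u v \<longleftrightarrow> adj v u"
  by (auto simp: adj_def)

lemma adj_simps [simp]:
  "adj Center Center \<longleftrightarrow> False"
  "adj Center (Leg i m) \<longleftrightarrow> m = 0"
  "adj (Leg i m) Center \<longleftrightarrow> m = 0"
  "adj (Leg i m) (Leg j n) \<longleftrightarrow> i = j \<and> (n = Suc m \<or> m = Suc n)"
  by (auto simp: adj_def child_def)

lemma verts_tree_on [simp]: "pverts (tree_on U) = U"
  by (simp add: tree_on_def)

lemma parcs_tree_on: "parcs (tree_on U) = {(u, v). u \<in> U \<and> v \<in> U \<and> adj u v}"
  by (simp add: tree_on_def)

lemma symmetric_tree_on: "symmetric (with_proj (tree_on U))"
  by (auto simp: symmetric_def sym_def parcs_tree_on adj_sym)

lemma pair_wf_tree_on: "pair_wf_digraph (tree_on U)"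
  by unfold_locales (auto simp: parcs_tree_on)

lemma graph_tree_on:
  assumes "finite U"
  shows "graph (with_proj (tree_on U))"
proof -
  have "parcs (tree_on U) \<subseteq> U \<times> U" by (auto simp: parcs_tree_on)
  then have fin: "finite (parcs (tree_on U))"
    using assms by (meson finite_SigmaI finite_subset)
  have "\<not> adj u u" for u by (cases u) auto
  then have "pair_graph (tree_on U)"
    using assms fin symmetric_tree_on[of U]
    by unfold_locales (auto simp: parcs_tree_on symmetric_def)
  then show ?thesis by (rule pair_graph.pair_graphD_graph)
qed

text \<open>Deleting vertices never leaves the family \<open>tree_on\<close>, which allows the whole
  game to be played on vertex sets.\<close>

lemma tree_on_restrict:
  assumes "V \<subseteq> U"
  shows "with_proj (tree_on U) \<restriction> V = with_proj (tree_on V)"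
  using assms by (auto simp: induce_subgraph_def with_proj_def parcs_tree_on)

lemma mk_symmetric_tree_on: "parcs (mk_symmetric (with_proj (tree_on U))) = parcs (tree_on U)"
  by (auto simp: parcs_mk_symmetric parcs_tree_on adj_sym)

text \<open>The arcs of \<open>tree_on U\<close> are already symmetric, so the symmetrization in the
  library definition of \<open>connected\<close> disappears.\<close>

lemma conn_iff_reachable:
  "conn U \<longleftrightarrow> U \<noteq> {} \<and> (\<forall>u\<in>U. \<forall>v\<in>U. (u, v) \<in> rtrancl_on U (parcs (tree_on U)))"
  by (auto simp: connected_def strongly_connected_def reachable_def mk_symmetric_tree_on)

lemma connI:
  assumes "r \<in> U" "\<And>v. v \<in> U \<Longrightarrow> (r, v) \<in> rtrancl_on U (parcs (tree_on U))"
  shows "conn U"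
proof -
  let ?A = "parcs (tree_on U)"
  have "?A\<inverse> = ?A" by (auto simp: parcs_tree_on adj_sym)
  then have "(v, r) \<in> rtrancl_on U ?A" if "v \<in> U" for v
    using assms(2)[OF that] rtrancl_on_converseI[of r v U ?A] by simp
  then show ?thesis
    using assms unfolding conn_iff_reachable by (blast intro: rtrancl_on_trans)
qed

lemma reach_step:
  assumes "(r, u) \<in> rtrancl_on U (parcs (tree_on U))" "v \<in> U" "adj u v"
  shows "(r, v) \<in> rtrancl_on U (parcs (tree_on U))"
  using assms in_rtrancl_on_in_F(2)[OF assms(1)]
  by (intro rtrancl_on_into_rtrancl_on[OF assms(1)]) (auto simp: parcs_tree_on)

text \<open>A walk from \<open>a\<close> to \<open>b\<close> has to leave \<open>A\<close> at some
  arc. Applied to suitable sets \<open>A\<close>, this yields the shapes of all connected sets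
  needed below.\<close>

lemma conn_cut:
  assumes "conn U" "A \<subseteq> U" "a \<in> A" "b \<in> U - A"
  shows "\<exists>u\<in>A. \<exists>v\<in>U - A. adj u v"
proof (rule ccontr)
  assume neg: "\<not> ?thesis"
  have "(a, b) \<in> rtrancl_on U (parcs (tree_on U))"
    using assms by (auto simp: conn_iff_reachable)
  then have "b \<in> A"
  proof (induction rule: rtrancl_on_induct)
    case (step y z)
    then show ?case using neg by (auto simp: parcs_tree_on)
  qed (use assms in auto)
  then show False using assms by simp
qed

text \<open>The removed subgraph need not be induced, but adding the missing arcs keeps it
  connected, so only its vertex set matters.\<close>

lemma conn_verts_subgraph:
  assumes "subgraph H (with_proj (tree_on U))" "connected H"
  shows "conn (verts H)"
proof -
  have arcs: "arcs H \<subseteq> parcs (tree_on U)" "tail H = tail (with_proj (tree_on U))"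
     "head H = head (with_proj (tree_on U))" and wf: "wf_digraph H"
    using assms(1) by (auto simp: subgraph_def compatible_def)
  have "parcs (mk_symmetric H) \<subseteq> parcs (tree_on (verts H))"
    using arcs wf_digraph.tail_in_verts[OF wf] wf_digraph.head_in_verts[OF wf]
    by (force simp: parcs_mk_symmetric parcs_tree_on adj_sym)
  then have "rtrancl_on (verts H) (parcs (mk_symmetric H))
      \<subseteq> rtrancl_on (verts H) (parcs (tree_on (verts H)))"
    by (auto intro: rtrancl_on_mono)
  moreover have "verts H \<noteq> {}"
      "\<forall>u\<in>verts H. \<forall>v\<in>verts H. (u, v) \<in> rtrancl_on (verts H) (parcs (mk_symmetric H))"
    using assms(2) by (auto simp: connected_def strongly_connected_def reachable_def)
  ultimately show ?thesis
    unfolding conn_iff_reachable by blast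
qed

section \<open>The game on vertex sets\<close>

text \<open>A move is represented by the set \<open>V\<close> of remaining vertices, not by the
  removed set.\<close>

definition moves :: "star_vertex set \<Rightarrow> star_vertex set set" where
  "moves U = {V. V \<subseteq> U \<and> card (U - V) \<in> {1, 2, 3} \<and> conn (U - V) \<and> (V = {} \<or> conn V)}"

definition val :: "star_vertex set \<Rightarrow> nat" where
  "val U = csg_grundy {1, 2, 3} (with_proj (tree_on U))"

lemma csg_move_tree_on:
  assumes "finite U"
  shows "csg_move {1, 2, 3} (with_proj (tree_on U)) G' \<longleftrightarrow>
    (\<exists>V\<in>moves U. G' = with_proj (tree_on V))" (is "?L \<longleftrightarrow> ?R")
proof
  assume ?L
  then obtain H where H: "subgraph H (with_proj (tree_on U))" "connected H"
      "card (verts H) \<in> {1, 2, 3}" "G' = with_proj (tree_on U) \<restriction> (U - verts H)"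
      "verts G' = {} \<or> connected G'"
    by (auto simp: csg_move_def)
  then have sub: "verts H \<subseteq> U" by (auto simp: subgraph_def)
  have G': "G' = with_proj (tree_on (U - verts H))"
    using H(4) tree_on_restrict[of "U - verts H" U] by simp
  have "U - (U - verts H) = verts H" using sub by auto
  then have "U - verts H \<in> moves U"
    using H G' conn_verts_subgraph[OF H(1,2)] by (auto simp: moves_def)
  then show ?R using G' by blast
next
  assume ?R
  then obtain V where V: "V \<in> moves U" "G' = with_proj (tree_on V)" by blast
  \<comment> \<open>Any subgraph with the right vertices would do; the induced one is symmetric and
    connected by assumption.\<close>
  let ?H = "with_proj (tree_on (U - V))"
  have "subgraph ?H (with_proj (tree_on U))"
    using pair_wf_tree_on
    by (auto simp: subgraph_def parcs_tree_on wf_digraph_wp_iff)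
  moreover have "G' = with_proj (tree_on U) \<restriction> (U - (U - V))"
    using V tree_on_restrict[of V U] by (auto simp: moves_def double_diff)
  ultimately show ?L
    using V graph_tree_on[OF assms] symmetric_tree_on[of "U - V"]
    unfolding csg_move_def
    by (intro conjI exI[of _ ?H]) (auto simp: moves_def)
qed

lemma finite_moves: "finite U \<Longrightarrow> finite (moves U)"
  by (rule finite_subset[of _ "Pow U"]) (auto simp: moves_def)

lemma val_rec:
  assumes "finite U"
  shows "val U = mex (val ` moves U)"
proof -
  have "{G'. csg_move {1, 2, 3} (with_proj (tree_on U)) G'} = (\<lambda>V. with_proj (tree_on V)) ` moves U"
    using csg_move_tree_on[OF assms] by auto
  then show ?thesis
    unfolding val_def by (subst csg_grundy.simps) (simp add: image_image)
qed

lemma val_move_neq: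
  assumes "finite U" "V \<in> moves U"
  shows "val V \<noteq> val U"
proof -
  \<comment> \<open>Finiteness of the set of options guarantees that the \<open>LEAST\<close> in
    \<open>mex\<close> is attained.\<close>
  have "\<exists>n. n \<notin> val ` moves U"
    using finite_moves[OF assms(1)] ex_new_if_finite infinite_UNIV_nat by blast
  then have "mex (val ` moves U) \<notin> val ` moves U"
    unfolding mex_def by (rule LeastI_ex)
  then show ?thesis using assms val_rec[OF assms(1)] by (metis imageI)
qed

lemma val_less_move:
  assumes "finite U" "n < val U"
  obtains V where "V \<in> moves U" "val V = n"
  using assms not_less_Least unfolding val_rec[OF assms(1)] mex_def by blast

text \<open>Were the value larger than \<open>n\<close>, some option would have value
  \<open>n\<close>; were it smaller, some option would share the value of \<open>U\<close>.\<close>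

lemma val_eqI:
  assumes "finite U" "\<And>V. V \<in> moves U \<Longrightarrow> val V \<noteq> n"
    and "\<And>m. m < n \<Longrightarrow> \<exists>V\<in>moves U. val V = m"
  shows "val U = n"
  using assms val_less_move[OF assms(1)] val_move_neq[OF assms(1)]
  by (metis linorder_neqE_nat)

section \<open>Paths as intervals of a two-sided line\<close>

text \<open>The legs \<open>i\<close> and \<open>j\<close> glued together at the center \<open>0\<close>, as a two-sided infinite path.\<close>

definition line :: "nat \<Rightarrow> nat \<Rightarrow> int \<Rightarrow> star_vertex" where
  "line i j x = (if x = 0 then Center else if 0 < x then Leg i (nat (x - 1)) else Leg j (nat (- x - 1)))"

lemma adj_line: "i \<noteq> j \<Longrightarrow> adj (line i j x) (line i j y) \<longleftrightarrow> \<bar>x - y\<bar> = 1"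
  by (auto simp: line_def)

lemma inj_line: "i \<noteq> j \<Longrightarrow> inj (line i j)"
  by (auto simp: inj_def line_def split: if_splits)

lemma conn_line:
  assumes "i \<noteq> j" "p < q"
  shows "conn (line i j ` {p..<q})"
proof (rule connI)
  let ?U = "line i j ` {p..<q}"
  show "line i j p \<in> ?U" using assms by simp
  have "x < q \<Longrightarrow> (line i j p, line i j x) \<in> rtrancl_on ?U (parcs (tree_on ?U))" if "p \<le> x" for x
    using that
  proof (induction rule: int_ge_induct)
    case (step x)
    show ?case
    proof (rule reach_step)
      show "(line i j p, line i j x) \<in> rtrancl_on ?U (parcs (tree_on ?U))"
        using step by simp
      show "line i j (x + 1) \<in> ?U" using step by (intro imageI) simp
      show "adj (line i j x) (line i j (x + 1))" by (simp add: adj_line[OF assms(1)])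
    qed
  qed (use assms in simp)
  then show "(line i j p, v) \<in> rtrancl_on ?U (parcs (tree_on ?U))" if "v \<in> ?U" for v
    using that by auto
qed

text \<open>Only consecutive coordinates are adjacent, so a missing coordinate between two points of
  \<open>V\<close> would disconnect them.\<close>

lemma conn_subset_line:
  assumes "i \<noteq> j" "conn V" "V \<subseteq> line i j ` {p..<q}"
  obtains p' q' where "p' < q'" "V = line i j ` {p'..<q'}"
proof -
  define S where "S = {x \<in> {p..<q}. line i j x \<in> V}"
  have V: "V = line i j ` S" using assms(3) by (auto simp: S_def)
  have fin: "finite S" unfolding S_def by (rule finite_subset[of _ "{p..<q}"]) auto
  have ne: "S \<noteq> {}" using assms(2) V by (auto simp: conn_iff_reachable)
  have "{Min S..<Max S + 1} \<subseteq> S"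
  proof
    fix x assume x: "x \<in> {Min S..<Max S + 1}"
    show "x \<in> S"
    proof (rule ccontr)
      assume "x \<notin> S"
      \<comment> \<open>The part of \<open>V\<close> beyond the gap \<open>x\<close>; an edge
        leaving it could only end at \<open>x\<close>.\<close>
      let ?A = "line i j ` {y \<in> S. x < y}"
      have mx: "Max S \<in> S" "Min S \<in> S" using fin ne by auto
      with \<open>x \<notin> S\<close> have "x \<noteq> Max S" "x \<noteq> Min S" by metis+
      with x have "x < Max S" "Min S < x" by simp_all
      then have in_A: "line i j (Max S) \<in> ?A" "line i j (Min S) \<notin> ?A"
        using mx by (auto dest: injD[OF inj_line[OF assms(1)]])
      have "line i j (Min S) \<in> V - ?A" using in_A mx(2) V by blast
      moreover have "?A \<subseteq> V" unfolding V by blast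
      ultimately have "\<exists>u\<in>?A. \<exists>v\<in>V - ?A. adj u v"
        by (intro conn_cut[OF assms(2) _ in_A(1)])
      then obtain u v where uv: "u \<in> ?A" "v \<in> V - ?A" "adj u v" by (elim bexE)
      from uv(1) obtain y where y: "y \<in> S" "x < y" "u = line i j y" by auto
      from uv(2) obtain z where z: "z \<in> S" "v = line i j z" unfolding V by blast
      then have "\<not> x < z" using uv(2) by blast
      moreover have "\<bar>y - z\<bar> = 1" using uv(3) y z adj_line[OF assms(1)] by simp
      ultimately have "z = x" using y by auto
      then show False using \<open>x \<notin> S\<close> z by simp
    qed
  qed
  moreover have "S \<subseteq> {Min S..<Max S + 1}"
  proof
    fix x assume "x \<in> S"
    then have "Min S \<le> x" "x \<le> Max S" using fin by simp_all
    then show "x \<in> {Min S..<Max S + 1}" by simp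
  qed
  ultimately have "S = {Min S..<Max S + 1}" by blast
  moreover have "Min S \<le> Max S" using fin ne by simp
  ultimately show ?thesis using V that[of "Min S" "Max S + 1"] by simp
qed

lemma card_line: "i \<noteq> j \<Longrightarrow> card (line i j ` {p..<q}) = nat (q - p)"
  by (subst card_image) (auto intro: inj_on_subset[OF inj_line])

lemma line_moves:
  assumes "i \<noteq> j" "k \<in> {1, 2, 3}" "p + k \<le> q"
  shows "line i j ` {p..<q - k} \<in> moves (line i j ` {p..<q})"
proof -
  have "{p..<q} - {p..<q - k} = {q - k..<q}" using assms by auto
  then have "line i j ` {p..<q} - line i j ` {p..<q - k} = line i j ` {q - k..<q}"
    using image_set_diff[OF inj_line[OF assms(1)]] by metis
  moreover have "{p..<q - k} = {} \<or> p < q - k" by auto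
  ultimately show ?thesis
    using assms conn_line[OF assms(1)] card_line[OF assms(1)]
    unfolding moves_def by auto
qed

text \<open>Together with \<open>mod4_diff_exists\<close>, this is the arithmetic of the one-heap
  game in which one to three tokens are taken.\<close>

lemma mod4_diff_neq:
  fixes a c n :: nat
  assumes "a + c = n" "c \<in> {1, 2, 3}"
  shows "a mod 4 \<noteq> n mod 4"
proof -
  have "a mod 4 \<noteq> (a + 1) mod 4" "a mod 4 \<noteq> (a + 2) mod 4" "a mod 4 \<noteq> (a + 3) mod 4"
    by presburger+
  then show ?thesis using assms by auto
qed

lemma mod4_diff_exists:
  fixes m n :: nat
  assumes "m < n mod 4"
  shows "\<exists>k\<in>{1, 2, 3}. k \<le> n \<and> (n - k) mod 4 = m"
proof -
  define d where "d = n div 4"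
  define k where "k = n mod 4 - m"
  have k: "n mod 4 = m + k" using assms by (simp add: k_def)
  then have n: "n = (m + k) + 4 * d"
    using mod_mult_div_eq[of n 4] by (simp add: d_def)
  have "m + k < 4" unfolding k[symmetric] by simp
  then have "k \<in> {1, 2, 3}" "(m + 4 * d) mod 4 = m" using assms k by auto
  moreover have "n - k = m + 4 * d" "k \<le> n" using n by simp_all
  ultimately show ?thesis by metis
qed

text \<open>What remains after a move is again an interval, possibly empty, so only the number of
  vertices counts and the path is a heap from which one to three tokens are taken. Cutting at the
  upper end realizes every such reduction.\<close>

lemma val_line:
  assumes "i \<noteq> j" "p \<le> q"
  shows "val (line i j ` {p..<q}) = nat (q - p) mod 4"
  using assms(2)
proof (induction "nat (q - p)" arbitrary: p q rule: less_induct)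
  case less
  let ?U = "line i j ` {p..<q}"
  show ?case
  proof (rule val_eqI)
    show "finite ?U" by simp
    show "val V \<noteq> nat (q - p) mod 4" if V: "V \<in> moves ?U" for V
    proof -
      have sub: "V \<subseteq> ?U" and c: "card (?U - V) \<in> {1, 2, 3}" and "V = {} \<or> conn V"
        using V by (auto simp: moves_def)
      then obtain p' q' where V': "p' \<le> q'" "V = line i j ` {p'..<q'}"
        using conn_subset_line[OF assms(1) _ sub] by (metis less_le atLeastLessThan_empty image_empty order_refl)
      have "card V + card (?U - V) = card ?U"
        using sub by (simp add: card_Diff_subset finite_subset card_mono)
      then have eq: "nat (q' - p') + card (?U - V) = nat (q - p)"
        using V' card_line[OF assms(1)] by simp
      then have "nat (q' - p') < nat (q - p)" using c by auto
      then have "val V = nat (q' - p') mod 4" using less V' by simp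
      then show ?thesis using mod4_diff_neq[OF eq c] by simp
    qed
    fix m assume "m < nat (q - p) mod 4"
    from mod4_diff_exists[OF this] obtain k where k: "k \<in> {1, 2, 3}" "k \<le> nat (q - p)"
      "(nat (q - p) - k) mod 4 = m" by blast
    have k': "int k \<in> {1, 2, 3}" "p + int k \<le> q" using k less.prems by auto
    have "nat (q - int k - p) = nat (q - p) - k" by auto
    moreover have "nat (q - p) - k < nat (q - p)" using k by auto
    ultimately have "val (line i j ` {p..<q - int k}) = m"
      using less.hyps[of "q - int k" p] k k' by simp
    then show "\<exists>V\<in>moves ?U. val V = m"
      using line_moves[OF assms(1) k'] by blast
  qed
qed

section \<open>Stars as vertex sets and their moves\<close>

text \<open>Leg lengths form a function with value 0 for absent legs, so shortening a leg is a
  function update and no order or number of legs has to be tracked.\<close>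

definition star :: "(nat \<Rightarrow> nat) \<Rightarrow> star_vertex set" where
  "star f = insert Center {Leg i m | i m. m < f i}"

lemma Center_in_star [simp]: "Center \<in> star f"
  by (simp add: star_def)

lemma Leg_in_star [simp]: "Leg i m \<in> star f \<longleftrightarrow> m < f i"
  by (simp add: star_def)

lemma star_vertex_set_eqI:
  assumes "Center \<in> U \<longleftrightarrow> Center \<in> V" "\<And>i m. Leg i m \<in> U \<longleftrightarrow> Leg i m \<in> V"
  shows "U = V"
  by (rule set_eqI) (metis assms star_vertex.exhaust)

lemma subdivided_star_eq_tree_on:
  "subdivided_star ls = tree_on (star (\<lambda>i. if i < length ls then ls ! i else 0))" (is "_ = tree_on (star ?f)")
proof -
  have "pverts (subdivided_star ls) = star ?f"
    by (auto simp: subdivided_star_def star_def)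
  moreover have "(u, v) \<in> parcs (subdivided_star ls) \<longleftrightarrow> (u, v) \<in> parcs (tree_on (star ?f))" for u v
    by (cases u; cases v) (auto simp: subdivided_star_def star_arcs_def parcs_tree_on)
  ultimately show ?thesis
    by (intro pair_pre_digraph.equality) auto
qed

lemma finite_star:
  assumes "finite {i. f i \<noteq> 0}"
  shows "finite (star f)"
proof -
  have "star f \<subseteq> insert Center (\<Union>i\<in>{i. f i \<noteq> 0}. Leg i ` {..<f i})"
  proof
    fix v assume "v \<in> star f"
    then show "v \<in> insert Center (\<Union>i\<in>{i. f i \<noteq> 0}. Leg i ` {..<f i})"
    proof (cases v)
      case (Leg i m)
      then have "f i \<noteq> 0" "v \<in> Leg i ` {..<f i}" using \<open>v \<in> star f\<close> by auto
      then show ?thesis by blast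
    qed simp
  qed
  then show ?thesis by (rule finite_subset) (use assms in simp)
qed

lemma conn_star: "conn (star f)"
proof (rule connI)
  show "Center \<in> star f" by simp
  let ?R = "rtrancl_on (star f) (parcs (tree_on (star f)))"
  have "m < f i \<Longrightarrow> (Center, Leg i m) \<in> ?R" for i m
  proof (induction m)
    case 0
    then show ?case by (intro reach_step[of Center Center, OF rtrancl_on_refl]) auto
  next
    case (Suc m)
    then show ?case by (intro reach_step[of Center "Leg i m", OF Suc.IH]) auto
  qed
  then show "(Center, v) \<in> ?R" if "v \<in> star f" for v
    using that by (cases v) auto
qed

lemma line_eq_Leg: "line i j x = Leg i' m \<longleftrightarrow> x = int m + 1 \<and> i' = i \<or> x = - int m - 1 \<and> i' = j"
  by (auto simp: line_def)

lemma line_eq_Center: "line i j x = Center \<longleftrightarrow> x = 0"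
  by (auto simp: line_def)

lemma Leg_in_line:
  "Leg i' m \<in> line i j ` X \<longleftrightarrow> int m + 1 \<in> X \<and> i' = i \<or> - int m - 1 \<in> X \<and> i' = j"
  unfolding image_iff using line_eq_Leg by metis

lemma Center_in_line: "Center \<in> line i j ` X \<longleftrightarrow> 0 \<in> X"
  unfolding image_iff using line_eq_Center by metis

text \<open>Two legs and the center form a path; the summand 1 counts the center.\<close>

lemma val_star_path:
  assumes "i \<noteq> j" "\<And>c. c \<noteq> i \<Longrightarrow> c \<noteq> j \<Longrightarrow> f c = 0"
  shows "val (star f) = (f i + f j + 1) mod 4"
proof -
  have "star f = line i j ` {- int (f j)..<int (f i) + 1}"
  proof (rule star_vertex_set_eqI)
    show "Leg i' m \<in> star f \<longleftrightarrow> Leg i' m \<in> line i j ` {- int (f j)..<int (f i) + 1}" for i' m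
      using assms by (cases "i' = i"; cases "i' = j") (auto simp: Leg_in_line)
  qed (simp add: Center_in_line)
  moreover have "nat (int (f i) + 1 - - int (f j)) = f i + f j + 1" by auto
  ultimately show ?thesis using val_line[OF assms(1), of "- int (f j)" "int (f i) + 1"] by simp
qed

text \<open>Transfers the results on the line to pieces of one leg. Any index other than
  \<open>i\<close> could replace \<open>Suc i\<close>; the shift by one is due to the center at
  coordinate 0.\<close>

lemma leg_segment_line: "Leg i ` {n..<m} = line i (Suc i) ` {int n + 1..<int m + 1}"
  by (rule star_vertex_set_eqI) (auto simp: Leg_in_line Center_in_line)

lemma val_leg: "val (Leg i ` {..<n}) = n mod 4"
  using val_line[of i "Suc i" 1 "int n + 1"] leg_segment_line[of i 0 n]
  by (simp add: lessThan_atLeast0)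

lemma star_diff_leg: "star f - star (f(i := n)) = Leg i ` {n..<f i}"
  by (rule star_vertex_set_eqI) auto

lemma star_leg_move:
  assumes "k \<in> {1, 2, 3}" "k \<le> f i"
  shows "star (f(i := f i - k)) \<in> moves (star f)"
proof -
  have "star (f(i := f i - k)) \<subseteq> star f"
    by (auto simp: star_def split: if_splits)
  moreover have "conn (Leg i ` {f i - k..<f i})"
    unfolding leg_segment_line using assms by (intro conn_line) auto
  moreover have "card (Leg i ` {f i - k..<f i}) = k"
    using assms by (subst card_image) (auto simp: inj_on_def)
  ultimately show ?thesis
    using assms(1) conn_star by (simp only: moves_def mem_Collect_eq star_diff_leg) simp
qed

text \<open>A vertex missing from a leg would cut off everything beyond it from the center, so
  \<open>V\<close> meets each leg in an initial segment.\<close>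

lemma conn_containing_Center:
  assumes "conn V" "Center \<in> V" "V \<subseteq> star f"
  obtains g where "V = star g"
proof -
  have down: "Leg i m \<in> V" if "Leg i n \<in> V" "m \<le> n" for i m n
  proof (rule ccontr)
    assume m: "Leg i m \<notin> V"
    let ?A = "{Leg i n | n. Leg i n \<in> V \<and> m \<le> n}"
    have "?A \<subseteq> V" "Leg i n \<in> ?A" "Center \<in> V - ?A" using that assms(2) by auto
    then have "\<exists>u\<in>?A. \<exists>v\<in>V - ?A. adj u v" by (rule conn_cut[OF assms(1)])
    then obtain n v where n: "m \<le> n" "Leg i n \<in> V" and v: "v \<in> V - ?A" "adj (Leg i n) v" by blast
    have "m < n" using n m by (metis le_neq_implies_less)
    then show False using v n by (cases v) auto
  qed
  \<comment> \<open>The first missing vertex of each leg; it exists because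
    \<open>Leg i (f i)\<close> lies outside \<open>star f\<close>.\<close>
  define g where "g i = (LEAST m. Leg i m \<notin> V)" for i
  have ex: "Leg i (f i) \<notin> V" for i using assms(3) by (auto simp: star_def)
  have "Leg i m \<in> V \<longleftrightarrow> m < g i" for i m
  proof
    assume "Leg i m \<in> V"
    moreover have "Leg i (g i) \<notin> V" unfolding g_def by (rule LeastI) (rule ex)
    ultimately show "m < g i" using down not_less by blast
  qed (use not_less_Least in \<open>auto simp: g_def\<close>)
  then have "V = star g" using assms(2) by (intro star_vertex_set_eqI) auto
  then show ?thesis by (rule that)
qed

text \<open>Distinct legs are joined only through the center.\<close>

lemma conn_avoiding_Center:
  assumes "conn V" "Center \<notin> V"
  obtains i where "V \<subseteq> range (Leg i)"
proof -
  obtain u where "u \<in> V" using assms(1) by (auto simp: conn_iff_reachable)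
  then obtain i m where u: "Leg i m \<in> V" using assms(2) by (cases u) auto
  have "V \<subseteq> range (Leg i)"
  proof (rule ccontr)
    assume "\<not> ?thesis"
    then obtain b where b: "b \<in> V - V \<inter> range (Leg i)" by blast
    have "V \<inter> range (Leg i) \<subseteq> V" "Leg i m \<in> V \<inter> range (Leg i)" using u by auto
    then have "\<exists>u\<in>V \<inter> range (Leg i). \<exists>v\<in>V - V \<inter> range (Leg i). adj u v"
      using b by (rule conn_cut[OF assms(1)])
    then obtain n v where "v \<in> V" "v \<notin> range (Leg i)" "adj (Leg i n) v" by blast
    then show False using assms(2) by (cases v) auto
  qed
  then show ?thesis by (rule that)
qed

text \<open>If the center stays, the removed set lies in one leg and the rest is a star. If it goes,
  the rest lies in one leg, so at least two other nontrivial legs vanish entirely; with the center,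
  one vertex from each already makes three, so nothing else is removed.\<close>

lemma star_move_cases:
  assumes fin: "finite {i. f i \<noteq> 0}" and V: "V \<in> moves (star f)"
    and three: "x \<noteq> y" "y \<noteq> z" "x \<noteq> z" "0 < f x" "0 < f y" "0 < f z"
  obtains (leg) i k where "k \<in> {1, 2, 3}" "k \<le> f i" "V = star (f(i := f i - k))"
  | (center) i a b where "i \<noteq> a" "i \<noteq> b" "a \<noteq> b" "f a = 1" "f b = 1"
      "\<And>c. c \<noteq> i \<Longrightarrow> c \<noteq> a \<Longrightarrow> c \<noteq> b \<Longrightarrow> f c = 0" "V = Leg i ` {..<f i}"
proof -
  let ?W = "star f - V"
  have sub: "V \<subseteq> star f" and c: "card ?W \<in> {1, 2, 3}" and W: "conn ?W"
    and V': "V = {} \<or> conn V" using V by (auto simp: moves_def)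
  have fW: "finite ?W" using finite_star[OF fin] by simp
  show ?thesis
  proof (cases "Center \<in> V")
    case True
    then have "conn V" using V' by auto
    then obtain g where g: "V = star g" using conn_containing_Center True sub by blast
    obtain i where i: "?W \<subseteq> range (Leg i)" using conn_avoiding_Center[OF W] True by blast
    have le: "g j \<le> f j" for j
    proof (rule ccontr)
      assume "\<not> g j \<le> f j"
      then have "Leg j (f j) \<in> V" by (simp add: g)
      then show False using sub by auto
    qed
    have "g j = f j" if "j \<noteq> i" for j
    proof (rule ccontr)
      assume "g j \<noteq> f j"
      then have "Leg j (g j) \<in> ?W" using le[of j] by (simp add: g)
      then have "Leg j (g j) \<in> range (Leg i)" using i by blast
      then show False using that by auto
    qed
    then have g_upd: "g = f(i := g i)" by auto
    then have "?W = Leg i ` {g i..<f i}" using g star_diff_leg by metis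
    then have "card ?W = f i - g i" by (simp add: card_image inj_on_def)
    then have "f i - g i \<in> {1, 2, 3}" using c by metis
    moreover have "f i - (f i - g i) = g i" using le[of i] by simp
    then have "V = star (f(i := f i - (f i - g i)))" using g g_upd by metis
    ultimately show ?thesis
      using diff_le_self by (intro leg[of "f i - g i" i])
  next
    case False
    \<comment> \<open>If \<open>V\<close> is empty, any \<open>i\<close> serves.\<close>
    have "\<exists>i. V \<subseteq> range (Leg i)"
      using V' False conn_avoiding_Center by blast
    then obtain i where i: "V \<subseteq> range (Leg i)" by blast
    have "\<exists>a b. a \<noteq> b \<and> i \<noteq> a \<and> i \<noteq> b \<and> 0 < f a \<and> 0 < f b"
      using three by metis
    then obtain a b where ab: "a \<noteq> b" "i \<noteq> a" "i \<noteq> b" "0 < f a" "0 < f b" by blast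
    have not_V: "Leg c m \<notin> V" if "c \<noteq> i" for c m
      using i that by blast
    let ?T = "{Center, Leg a 0, Leg b 0}"
    have "?T \<subseteq> ?W" using ab False not_V by auto
    moreover have "card ?W \<le> card ?T" using c ab by auto
    ultimately have W_eq: "?W = ?T" using card_seteq[OF fW] by blast
    have iff: "m < f c \<longleftrightarrow> Leg c m \<in> V \<or> Leg c m \<in> ?T" for c m
      using W_eq sub Leg_in_star[of c m f] by blast
    show ?thesis
    proof (rule center)
      show "f a = 1" "f b = 1"
        using iff[of 1 a] iff[of 1 b] not_V ab by auto
      show "f c = 0" if "c \<noteq> i" "c \<noteq> a" "c \<noteq> b" for c
        using iff[of 0 c] not_V that by auto
      show "V = Leg i ` {..<f i}"
      proof (rule star_vertex_set_eqI)
        show "Leg c m \<in> V \<longleftrightarrow> Leg c m \<in> Leg i ` {..<f i}" for c m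
          using iff[of m i] ab not_V by (cases "c = i") auto
      qed (use False in auto)
    qed (use ab in auto)
  qed
qed

section \<open>Stars with legs \<open>l, 1, 1\<close>\<close>

lemma mod4_add_neq:
  fixes n :: nat
  shows "n mod 4 \<noteq> (n + 1) mod 4" "n mod 4 \<noteq> (n + 2) mod 4" "n mod 4 \<noteq> (n + 3) mod 4"
  by presburger+

text \<open>Such a star behaves like a path with the same number \<open>f i + 3\<close> of vertices:
  every option has its number of vertices modulo 4 as value, and shortening the leg \<open>i\<close>
  attains all smaller values.\<close>

lemma val_star_spider:
  assumes "i \<noteq> a" "i \<noteq> b" "a \<noteq> b" "f a = 1" "f b = 1"
    and "\<And>c. c \<noteq> i \<Longrightarrow> c \<noteq> a \<Longrightarrow> c \<noteq> b \<Longrightarrow> f c = 0"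
  shows "val (star f) = (f i + 3) mod 4"
  using assms(4-)
proof (induction "f i" arbitrary: f rule: less_induct)
  case less
  note ones = less.prems(1,2) and zero = less.prems(3)
  have support: "c \<in> {i, a, b}" if "f c \<noteq> 0" for c using zero[of c] that
    by (cases "c = i"; cases "c = a"; cases "c = b") simp_all
  have "{i. f i \<noteq> 0} \<subseteq> {i, a, b}" using support by (intro subsetI) simp
  then have fin: "finite {i. f i \<noteq> 0}" by (rule finite_subset) simp
  have shorter: "val (star (f(i := f i - k))) = (f i - k + 3) mod 4" if "k \<in> {1, 2, 3}" "k \<le> f i" for k
  proof -
    let ?g = "f(i := f i - k)"
    have "val (star ?g) = (?g i + 3) mod 4"
    proof (rule less.hyps)
      show "?g i < f i" using that by auto
      show "?g a = 1" "?g b = 1" using ones assms(1,2) by simp_all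
      show "?g c = 0" if "c \<noteq> i" "c \<noteq> a" "c \<noteq> b" for c using zero that by simp
    qed
    then show ?thesis by simp
  qed
  show ?case
  \<comment> \<open>With leg \<open>i\<close> empty the star is a path on three vertices, and
    \<open>star_move_cases\<close> does not apply.\<close>
  proof (cases "f i = 0")
    case True
    then have "val (star f) = (f a + f b + 1) mod 4"
      using zero by (intro val_star_path[OF assms(3)]) metis
    then show ?thesis using True ones by simp
  next
    case False
    show ?thesis
    proof (rule val_eqI)
      show "finite (star f)" using fin by (rule finite_star)
      fix V assume V: "V \<in> moves (star f)"
      have "0 < f i" "0 < f a" "0 < f b" using False ones by auto
      from fin V assms(1,3,2) this show "val V \<noteq> (f i + 3) mod 4"
      proof (cases rule: star_move_cases)
        case (leg j k)
        consider "j = i" | "j = a" | "j = b"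
          using leg(1,2) support[of j] by fastforce
        then show ?thesis
        proof cases
          case 1
          have "f i + 3 - k + k = f i + 3" using leg 1 by auto
          moreover have "f i - k + 3 = f i + 3 - k" using leg 1 by auto
          ultimately show ?thesis
            using shorter[of k] leg 1 mod4_diff_neq[of "f i + 3 - k" k "f i + 3"] by simp
        next
          case 2
          have "k = 1" using leg 2 ones by auto
          then have "val V = (f i + f b + 1) mod 4"
            using leg 2 ones zero assms(1-3) val_star_path[OF assms(2), of "f(a := 0)"] by auto
          then show ?thesis using ones mod4_add_neq(1)[of "f i + 2"] by (simp add: add.commute)
        next
          case 3
          have "k = 1" using leg 3 ones by auto
          then have "val V = (f i + f a + 1) mod 4"
            using leg 3 ones zero assms(1-3) val_star_path[OF assms(1), of "f(b := 0)"] by auto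
          then show ?thesis using ones mod4_add_neq(1)[of "f i + 2"] by (simp add: add.commute)
        qed
      next
        case (center j c d)
        \<comment> \<open>The surviving leg \<open>j\<close> may differ from \<open>i\<close>, but
          only when all three legs have length 1.\<close>
        have "f j = f i"
        proof (cases "j = i")
          case False
          have "i = c \<or> i = d" using center(6)[of i] False \<open>f i \<noteq> 0\<close> by metis
          then have "f i = 1" using center by auto
          moreover have "j = a \<or> j = b"
            using center(6)[of a] center(6)[of b] ones assms(1-3) \<open>i = c \<or> i = d\<close> by auto
          ultimately show ?thesis using ones by auto
        qed simp
        then have "val V = f i mod 4" using center val_leg by simp
        then show ?thesis using mod4_add_neq(3) by simp
      qed
    next
      fix m assume m: "m < (f i + 3) mod 4"
      then obtain k where k: "k \<in> {1, 2, 3}" "k \<le> f i + 3" "(f i + 3 - k) mod 4 = m"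
        using mod4_diff_exists by blast
      \<comment> \<open>For \<open>f i = 1\<close> the value is 0 and there is no smaller
        \<open>m\<close>; for \<open>f i = 2\<close> only \<open>m = 0\<close> occurs, which
        \<open>k = 3\<close> does not produce.\<close>
      have "k \<le> f i"
      proof (rule ccontr)
        assume "\<not> k \<le> f i"
        then have "f i = 1 \<or> f i = 2 \<and> k = 3" using k(1) False by auto
        then show False using m k(3) by auto
      qed
      then have "val (star (f(i := f i - k))) = m"
        using shorter[of k] k by simp
      then show "\<exists>V\<in>moves (star f). val V = m"
        using star_leg_move[of k f i] k \<open>k \<le> f i\<close> by blast
    qed
  qed
qed

section \<open>Stars whose value is determined by leg moves\<close>

text \<open>
  Stars with at least two nontrivial legs, other than \<open>S\<^sub>1\<^sub>,\<^sub>1\<close>.  For these, moves removing the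
  center do not influence the value.
\<close>

definition leg_determined :: "(nat \<Rightarrow> nat) \<Rightarrow> bool" where
  "leg_determined f \<longleftrightarrow>
     (\<exists>a b. a \<noteq> b \<and> 0 < f a \<and> 0 < f b \<and> (1 < f a \<or> (\<exists>c. c \<noteq> a \<and> c \<noteq> b \<and> 0 < f c)))"

text \<open>With three nontrivial legs, the only other move removes the center of a star with legs
  \<open>l, 1, 1\<close>, and its value \<open>l mod 4\<close> can be reached by shortening a leg
  instead. With two legs, the star is a path, and the number of vertices to remove fits into one
  leg.\<close>

lemma leg_option_exists:
  assumes fin: "finite {i. f i \<noteq> 0}" and "leg_determined f" and m: "m < val (star f)"
  obtains i k where "k \<in> {1, 2, 3}" "k \<le> f i" "val (star (f(i := f i - k))) = m"
proof -
  obtain a b where ab: "a \<noteq> b" "0 < f a" "0 < f b"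
    and disj: "1 < f a \<or> (\<exists>c. c \<noteq> a \<and> c \<noteq> b \<and> 0 < f c)"
    using assms(2) unfolding leg_determined_def by blast
  show ?thesis
  proof (cases "\<exists>c. c \<noteq> a \<and> c \<noteq> b \<and> 0 < f c")
    case True
    then obtain c where c: "b \<noteq> c" "a \<noteq> c" "0 < f c" by metis
    obtain V where V: "V \<in> moves (star f)" "val V = m"
      using val_less_move[OF finite_star[OF fin] m] by blast
    from fin V(1) ab(1) c(1,2) ab(2,3) c(3) show ?thesis
    proof (cases rule: star_move_cases)
      case (leg i k)
      then show ?thesis using that V by blast
    next
      case (center i x y)
      have f: "val (star f) = (f i + 3) mod 4" using center by (intro val_star_spider[of i x y]) auto
      have m_eq: "m = f i mod 4" using center V val_leg by simp
      have pos: "0 < f i"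
        using center(3-6) ab c by (metis gr0I)
      \<comment> \<open>\<open>r < (r + 3) mod 4\<close> with \<open>r = f i mod 4\<close> forces
        \<open>r = 0\<close>; removing three vertices of leg \<open>i\<close> then gives the same
        value 0.\<close>
      have "f i mod 4 = 0" using m unfolding f m_eq by presburger
      then have "3 \<le> f i" using pos by presburger
      have "val (star (f(i := f i - 3))) = (f i - 3 + 3) mod 4"
        using val_star_spider[of i x y "f(i := f i - 3)"] center by auto
      then have "val (star (f(i := f i - 3))) = m" using m_eq \<open>3 \<le> f i\<close> by simp
      then show ?thesis using that[of 3 i] \<open>3 \<le> f i\<close> by simp
    qed
  next
    case False
    then have zero: "\<And>c. c \<noteq> a \<Longrightarrow> c \<noteq> b \<Longrightarrow> f c = 0" and "1 < f a" using disj by auto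
    have f: "val (star f) = (f a + f b + 1) mod 4" using zero by (intro val_star_path[OF ab(1)])
    obtain k where k: "k \<in> {1, 2, 3}" "k \<le> f a + f b + 1" "(f a + f b + 1 - k) mod 4 = m"
      using mod4_diff_exists m unfolding f by blast
    have "k \<le> f a \<or> k \<le> f b"
    proof (rule ccontr)
      assume neg: "\<not> (k \<le> f a \<or> k \<le> f b)"
      \<comment> \<open>The remaining leg pairs \<open>2, 1\<close> and \<open>2, 2\<close> have
        values 0 and 1; \<open>k = 3\<close> leads to no smaller value from either.\<close>
      then have "k = 3" "f a = 2" "f b = 1 \<or> f b = 2" using k(1) \<open>1 < f a\<close> ab(3) by auto
      then show False using m k(3) unfolding f by auto
    qed
    then show ?thesis
    proof
      assume le: "k \<le> f a"
      have "val (star (f(a := f a - k))) = (f a - k + f b + 1) mod 4"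
        using zero val_star_path[OF ab(1), of "f(a := f a - k)"] ab by auto
      moreover have "f a - k + f b + 1 = f a + f b + 1 - k" using le by simp
      ultimately show ?thesis using that[of k a] le k by metis
    next
      assume le: "k \<le> f b"
      have "val (star (f(b := f b - k))) = (f a + (f b - k) + 1) mod 4"
        using zero val_star_path[OF ab(1), of "f(b := f b - k)"] ab by auto
      moreover have "f a + (f b - k) + 1 = f a + f b + 1 - k" using le by simp
      ultimately show ?thesis using that[of k b] le k by metis
    qed
  qed
qed

section \<open>Adding four vertices to a leg, and reduction modulo 4\<close>

text \<open>The exceptions are stars with at most one nontrivial leg and the star with legs
  \<open>1, 1\<close>. Lengthening yields a path again, except that a new leg on the latter gives
  legs \<open>4, 1, 1\<close>, of value 3 like the path on three vertices.\<close>

lemma val_star_not_leg_determined: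
  assumes "\<not> leg_determined f"
  shows "val (star (f(i := f i + 4))) = val (star f)"
proof (cases "\<exists>a b. a \<noteq> b \<and> 0 < f a \<and> 0 < f b")
  case True
  then obtain a b where ab: "a \<noteq> b" "0 < f a" "0 < f b" by blast
  then have "\<not> 1 < f a" "\<not> 1 < f b"
    using assms unfolding leg_determined_def by metis+
  then have ones: "f a = 1" "f b = 1" using ab by auto
  have zero: "f c = 0" if "c \<noteq> a" "c \<noteq> b" for c
    using assms ab that unfolding leg_determined_def by (metis gr0I)
  have f: "val (star f) = (f a + f b + 1) mod 4" using zero by (intro val_star_path[OF ab(1)])
  show ?thesis
  proof (cases "i = a \<or> i = b")
    case True
    have "val (star (f(i := f i + 4))) = ((f(i := f i + 4)) a + (f(i := f i + 4)) b + 1) mod 4"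
      using zero True by (intro val_star_path[OF ab(1)]) auto
    then show ?thesis using f True ones ab(1) by auto
  next
    case False
    then have "val (star (f(i := f i + 4))) = ((f(i := f i + 4)) i + 3) mod 4"
      using ones zero ab(1) by (intro val_star_spider[of i a b]) auto
    then show ?thesis using f ones zero[of i] False by simp
  qed
next
  case False
  \<comment> \<open>If \<open>i\<close> is not the nontrivial leg, \<open>a\<close> is that leg;
    otherwise any other index serves.\<close>
  then obtain a where a: "a \<noteq> i" "\<And>c. c \<noteq> i \<Longrightarrow> c \<noteq> a \<Longrightarrow> f c = 0"
    by (metis gr0I n_not_Suc_n)
  have "val (star f) = (f i + f a + 1) mod 4"
    using a by (intro val_star_path) auto
  moreover have "val (star (f(i := f i + 4))) = ((f(i := f i + 4)) i + (f(i := f i + 4)) a + 1) mod 4"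
    using a by (intro val_star_path) auto
  moreover have "(f i + 4 + f a + 1) mod 4 = (f i + f a + 1) mod 4" by presburger
  ultimately show ?thesis using a(1) by simp
qed

lemma leg_determined_upd: "leg_determined f \<Longrightarrow> leg_determined (f(i := f i + 4))"
proof -
  assume "leg_determined f"
  then obtain a b where "a \<noteq> b" "0 < f a" "0 < f b" "1 < f a \<or> (\<exists>c. c \<noteq> a \<and> c \<noteq> b \<and> 0 < f c)"
    unfolding leg_determined_def by blast
  moreover have "f c \<le> (f(i := f i + 4)) c" for c by simp
  ultimately show ?thesis
    unfolding leg_determined_def by (meson less_le_trans)
qed

text \<open>If the two values differed, the smaller would be the value of a leg option of the other
  star. By induction that option has a counterpart of equal value among the options of the star with
  the smaller value, unless it cuts into the added vertices.\<close>

lemma val_star_add_4: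
  assumes "finite {i. f i \<noteq> 0}"
  shows "val (star (f(i := f i + 4))) = val (star f)"
  using assms
proof (induction "card (star f)" arbitrary: f rule: less_induct)
  case less
  let ?f = "f(i := f i + 4)"
  have fin: "finite {j. g j \<noteq> 0}" if "\<And>j. j \<noteq> i \<Longrightarrow> g j \<le> f j" for g :: "nat \<Rightarrow> nat"
  proof (rule finite_subset)
    show "{j. g j \<noteq> 0} \<subseteq> insert i {j. f j \<noteq> 0}" using that by fastforce
    show "finite (insert i {j. f j \<noteq> 0})" using less.prems by simp
  qed
  have fin': "finite {j. ?f j \<noteq> 0}" by (rule fin) simp
  show ?case
  proof (cases "leg_determined f")
    case False
    then show ?thesis by (rule val_star_not_leg_determined)
  next
    case True
    have IH: "val (star (?f(j := ?f j - k))) = val (star (f(j := f j - k)))"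
      and neq: "val (star (f(j := f j - k))) \<noteq> val (star f)"
      and neq': "val (star (?f(j := ?f j - k))) \<noteq> val (star ?f)"
      if k: "k \<in> {1, 2, 3}" "k \<le> f j" for j k
    proof -
      let ?g = "f(j := f j - k)"
      have move: "star ?g \<in> moves (star f)" using k by (rule star_leg_move)
      have "Leg j (f j - k) \<in> star f - star ?g" using k by auto
      moreover have "star ?g \<subseteq> star f" using move by (simp add: moves_def)
      ultimately have "card (star ?g) < card (star f)"
        by (intro psubset_card_mono finite_star less.prems) blast
      then have "val (star (?g(i := ?g i + 4))) = val (star ?g)"
        by (rule less.hyps) (rule fin, simp)
      \<comment> \<open>For \<open>j = i\<close> the hypothesis \<open>k \<le> f j\<close> is
        essential, since subtraction on \<open>nat\<close> is truncated.\<close>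
      moreover have "?g(i := ?g i + 4) = ?f(j := ?f j - k)" using k by (auto simp: fun_eq_iff)
      ultimately show "val (star (?f(j := ?f j - k))) = val (star ?g)" by simp
      show "val (star ?g) \<noteq> val (star f)"
        using finite_star[OF less.prems] move by (rule val_move_neq)
      show "val (star (?f(j := ?f j - k))) \<noteq> val (star ?f)"
        using k by (intro val_move_neq finite_star[OF fin'] star_leg_move) auto
    qed
    show ?thesis
    proof (rule linorder_cases)
      assume "val (star ?f) < val (star f)"
      then obtain j k where "k \<in> {1, 2, 3}" "k \<le> f j" "val (star (f(j := f j - k))) = val (star ?f)"
        using leg_option_exists[OF less.prems True] by blast
      then show ?thesis using IH neq' by metis
    next
      assume "val (star f) < val (star ?f)"
      then obtain j k where k: "k \<in> {1, 2, 3}" "k \<le> ?f j" "val (star (?f(j := ?f j - k))) = val (star f)"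
        using leg_option_exists[OF fin' leg_determined_upd[OF True]] by blast
      show ?thesis
      proof (cases "k \<le> f j")
        case True
        then show ?thesis using IH neq k by metis
      next
        case False
        \<comment> \<open>A move eating into the four added vertices leaves a position that has
          \<open>star f\<close> itself as an option.\<close>
        then have "j = i" using k(2) by (auto split: if_splits)
        let ?g = "?f(i := ?f i - k)"
        have f_eq: "?g(i := ?g i - (4 - k)) = f" using False k(1) \<open>j = i\<close> by auto
        have "star (?g(i := ?g i - (4 - k))) \<in> moves (star ?g)"
          using k(1) by (intro star_leg_move) auto
        then have "star f \<in> moves (star ?g)" unfolding f_eq .
        moreover have "finite (star ?g)" by (intro finite_star fin) simp
        ultimately have "val (star f) \<noteq> val (star ?g)" by (intro val_move_neq)
        then show ?thesis using k(3) \<open>j = i\<close> by simp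
      qed
    qed
  qed
qed

text \<open>Four vertices are stripped from one leg at a time, by induction on the number of
  vertices.\<close>

lemma val_star_mod_4:
  assumes "finite {i. f i \<noteq> 0}"
  shows "val (star f) = val (star (\<lambda>i. f i mod 4))"
  using assms
proof (induction "card (star f)" arbitrary: f rule: less_induct)
  case less
  show ?case
  proof (cases "\<exists>i. 4 \<le> f i")
    case True
    then obtain i where i: "4 \<le> f i" by blast
    let ?g = "f(i := f i - 4)"
    have f_eq: "?g(i := ?g i + 4) = f" using i by auto
    have "{j. ?g j \<noteq> 0} \<subseteq> {j. f j \<noteq> 0}" by auto
    then have fin: "finite {j. ?g j \<noteq> 0}" using less.prems by (rule finite_subset)
    have "star ?g \<subseteq> star f" by (auto simp: star_def split: if_splits)
    moreover have "Leg i (f i - 4) \<in> star f - star ?g" using i by auto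
    ultimately have "card (star ?g) < card (star f)"
      by (intro psubset_card_mono finite_star less.prems) blast
    then have "val (star ?g) = val (star (\<lambda>j. ?g j mod 4))"
      using fin by (rule less.hyps)
    moreover have "(\<lambda>j. ?g j mod 4) = (\<lambda>j. f j mod 4)"
      using i by (auto simp: fun_eq_iff le_mod_geq)
    moreover have "val (star f) = val (star ?g)"
      using val_star_add_4[OF fin, of i] unfolding f_eq .
    ultimately show ?thesis by metis
  next
    case False
    then have "(\<lambda>i. f i mod 4) = f" by (auto simp: fun_eq_iff not_le)
    then show ?thesis by simp
  qed
qed

theorem theorem16:
  fixes ls :: "nat list"
  shows "csg_grundy {1, 2, 3} (subdivided_star ls) =
         csg_grundy {1, 2, 3} (subdivided_star (map (\<lambda>l. l mod 4) ls))"
proof -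
  let ?f = "\<lambda>i. if i < length ls then ls ! i else 0"
  have "{i. ?f i \<noteq> 0} \<subseteq> {..<length ls}" by auto
  then have "finite {i. ?f i \<noteq> 0}" by (rule finite_subset) simp
  then have "val (star ?f) = val (star (\<lambda>i. ?f i mod 4))" by (rule val_star_mod_4)
  \<comment> \<open>The padding value 0 is fixed by reduction modulo 4.\<close>
  moreover have "(\<lambda>i. ?f i mod 4) =
      (\<lambda>i. if i < length (map (\<lambda>l. l mod 4) ls) then map (\<lambda>l. l mod 4) ls ! i else 0)"
    by auto
  ultimately show ?thesis
    unfolding subdivided_star_eq_tree_on val_def by simp
qed

end
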